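(* For $\mathrm{Re}(s)>2$ the following identity holds: $$D_2(s)\,\zeta(s)=2\Bigl(\sum_{n=1}^\infty\frac{d(n)}{n^s}\Bigr)\sum_{p\text{ prime}}\frac{p-1}{p^s}\prod_{\substack{q\text{ prime}\\ q\le p-1}}\Bigl(1-\frac1{q^s}\Bigr)+\sum_{n=1}^\infty\frac{\omega_0(n)}{n^s}-\sum_{n=1}^\infty\frac{\omega_1(n)}{n^s}.$$
   Context: $\zeta$ is the Riemann zeta function. $D_2(s)=\sum_{n=2}^\infty A(n,2)n^{-s}$, where $A(n,2)$ (a Cyrillic "el" in the paper) is the number of pairs $(\lambda_1,\lambda_2)\in\mathbb Z_{>0}^2$ with $\lambda_1+\lambda_2=n$ and $\min\{\lambda_1,\lambda_2\}<p_1(n)$, with $p_1(n)$ the smallest prime divisor of $n$; explicitly $A(n,2)=n-1$ if $n$ is prime and $A(n,2)=2(p_1(n)-1)$ if $n$ is composite. (It counts the Grassmannians of proper non-zero subspaces of $\mathbb C^n$ with non-exceeding, i.e. simple, quantum spectrum.) The series $D_2(s)$ converges absolutely for $\mathrm{Re}(s)>2$. The arithmetic functions are: $d(n)$ = number of (proper and improper) divisors of $n$; $\omega_0(n)$ = number of distinct prime factors of $n$; $\omega_1(n)$ = sum of the distinct prime factors of $n$; with $d(1)=1$ and $\omega_0(1)=\omega_1(1)=0$. *)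

theory Defs
  imports "HOL-Analysis.Analysis" "HOL-Computational_Algebra.Primes"
begin

(* Only meaningful for n > 1. *)
definition smallest_prime_divisor :: "nat \<Rightarrow> nat" where
  "smallest_prime_divisor n = (LEAST p. prime p \<and> p dvd n)"

(* The coefficient A(n,2). Pairs are ordered. *)
definition non_exceeding_count :: "nat \<Rightarrow> nat" where
  "non_exceeding_count n =
     card {(l1 :: nat, l2 :: nat). 0 < l1 \<and> 0 < l2 \<and> l1 + l2 = n \<and>
             min l1 l2 < smallest_prime_divisor n}"

definition num_divisors :: "nat \<Rightarrow> nat" where
  "num_divisors n = card {k. k dvd n}"

definition omega0 :: "nat \<Rightarrow> nat" where
  "omega0 n = card (prime_factors n)"

definition omega1 :: "nat \<Rightarrow> nat" where
  "omega1 n = \<Sum>(prime_factors n)"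

(* infsum is unconditional summation, i.e. for complex terms the value of an absolutely
   convergent series, and 0 if the series does not converge absolutely. *)

(* The Riemann zeta function on the half-plane Re s > 1. The analytic continuation is not
   modelled, so the value is not zeta(s) for other s. *)
definition riemann_zeta :: "complex \<Rightarrow> complex" where
  "riemann_zeta s = (\<Sum>\<^sub>\<infinity>n\<in>{1::nat..}. 1 / of_nat n powr s)"

definition D2 :: "complex \<Rightarrow> complex" where
  "D2 s = (\<Sum>\<^sub>\<infinity>n\<in>{2::nat..}. of_nat (non_exceeding_count n) / of_nat n powr s)"

(* The summand of the sum over primes p. *)
definition prime_summand :: "complex \<Rightarrow> nat \<Rightarrow> complex" where
  "prime_summand s p =
     (of_nat p - 1) / of_nat p powr s *
     (\<Prod>q | prime q \<and> q \<le> p - 1. 1 - 1 / of_nat q powr s)"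

end

theory Submission
  imports Defs
begin

text \<open>
  Write \<open>p\<^sub>1(n)\<close> for the smallest prime divisor of \<open>n\<close>. For composite \<open>n\<close> the coefficient of
  \<open>D\<^sub>2\<close> is \<open>2 (p\<^sub>1(n) - 1)\<close>, and for prime \<open>n\<close> this expression exceeds the coefficient by \<open>n - 1\<close>
  (lemma \<open>of_nat_non_exceeding_count\<close>). Hence
  \<open>D\<^sub>2(s) = 2 (\<Sum>n\<ge>2. (p\<^sub>1(n) - 1) n\<^sup>-\<^sup>s) - (\<Sum>p prime. (p - 1) p\<^sup>-\<^sup>s)\<close>.

  An integer with smallest prime divisor \<open>p\<close> is \<open>p m\<close> for a unique \<open>m\<close> without prime divisors
  below \<open>p\<close>, and the sum of \<open>m\<^sup>-\<^sup>s\<close> over all such \<open>m\<close> is \<open>\<zeta>(s)\<close> without its Euler factors at the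
  primes \<open>q < p\<close>, that is, \<open>\<zeta>(s) (\<Prod>q<p. 1 - q\<^sup>-\<^sup>s)\<close> (lemma \<open>sieved_has_sum\<close>). So the first sum is
  \<open>\<zeta>(s)\<close> times the sum over primes in the theorem (lemma \<open>smallest_prime_divisor_has_sum\<close>).

  After multiplication by \<open>\<zeta>(s)\<close> the first part contains \<open>\<zeta>(s)\<^sup>2\<close>, the Dirichlet series of the
  divisor function, and the second part splits into \<open>\<zeta>(s) (\<Sum>p. p\<^sup>-\<^sup>s)\<close> and \<open>\<zeta>(s) (\<Sum>p. p p\<^sup>-\<^sup>s)\<close>, which
  are the Dirichlet series of \<open>\<omega>\<^sub>0\<close> and \<open>\<omega>\<^sub>1\<close>. All three are instances of Dirichlet convolution
  (lemma \<open>dirichlet_convolution_has_sum\<close>). Every rearrangement is legitimate because coefficients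
  of absolute value at most \<open>n\<close> give an absolutely convergent series for \<open>Re s > 2\<close>.
\<close>

section \<open>The coefficients of $D_2$\<close>

lemma smallest_prime_divisor_props:
  assumes "n \<ge> 2"
  shows "prime (smallest_prime_divisor n)" "smallest_prime_divisor n dvd n"
    and "\<And>q. prime q \<Longrightarrow> q dvd n \<Longrightarrow> smallest_prime_divisor n \<le> q"
proof -
  have "\<exists>p. prime p \<and> p dvd n"
    using assms by (metis One_nat_def Suc_1 not_less_eq_eq order_refl prime_factor_nat)
  from LeastI_ex[OF this]
  show "prime (smallest_prime_divisor n)" "smallest_prime_divisor n dvd n"
    by (auto simp: smallest_prime_divisor_def)
  show "smallest_prime_divisor n \<le> q" if "prime q" "q dvd n" for q
    unfolding smallest_prime_divisor_def using that by (intro Least_le) auto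
qed

lemma smallest_prime_divisor_eqI:
  assumes "prime p" "p dvd n" "\<And>q. prime q \<Longrightarrow> q dvd n \<Longrightarrow> p \<le> q"
  shows "smallest_prime_divisor n = p"
  unfolding smallest_prime_divisor_def using assms by (intro Least_equality) auto

lemma smallest_prime_divisor_prime: "prime p \<Longrightarrow> smallest_prime_divisor p = p"
  by (rule smallest_prime_divisor_eqI) (auto dest: primes_dvd_imp_eq)

text \<open>The cofactor of the smallest prime divisor of a composite \<open>n\<close> is at least \<open>2\<close>. This keeps the
  pairs with a small first entry apart from those with a small second entry.\<close>
lemma two_smallest_prime_divisor_le:
  assumes "n \<ge> 2" "\<not> prime n"
  shows "2 * smallest_prime_divisor n \<le> n"
proof -
  note p = smallest_prime_divisor_props[OF assms(1)]
  obtain k where k: "n = smallest_prime_divisor n * k" using p(2) by blast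
  have "k \<noteq> 0" "k \<noteq> 1" using k p(1) assms by auto
  hence "k \<ge> 2" by simp
  thus ?thesis by (subst (2) k) (metis mult.commute mult_le_mono2)
qed

lemma non_exceeding_count_eq_card:
  "non_exceeding_count n =
     card {l \<in> {0<..<n}. l < smallest_prime_divisor n \<or> n - l < smallest_prime_divisor n}"
    (is "_ = card ?L")
proof -
  have "bij_betw (\<lambda>l. (l, n - l)) ?L {(l1, l2). 0 < l1 \<and> 0 < l2 \<and> l1 + l2 = n \<and>
             min l1 l2 < smallest_prime_divisor n}"
    by (rule bij_betw_byWitness[where f' = fst]) (auto simp: min_def split: if_splits)
  from bij_betw_same_card[OF this] show ?thesis by (simp only: non_exceeding_count_def)
qed

lemma non_exceeding_count_prime:
  assumes "prime n" shows "non_exceeding_count n = n - 1"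
proof -
  have "{l \<in> {0<..<n}. l < smallest_prime_divisor n \<or> n - l < smallest_prime_divisor n} = {0<..<n}"
    using assms by (auto simp: smallest_prime_divisor_prime)
  thus ?thesis by (simp add: non_exceeding_count_eq_card)
qed

lemma non_exceeding_count_composite:
  assumes "n \<ge> 2" "\<not> prime n"
  shows "non_exceeding_count n = 2 * (smallest_prime_divisor n - 1)"
proof -
  let ?p = "smallest_prime_divisor n"
  have p: "2 * ?p \<le> n" using assms by (rule two_smallest_prime_divisor_le)
  have "?p > 0" using smallest_prime_divisor_props(1)[OF assms(1)] prime_gt_0_nat by auto
  hence "{l \<in> {0<..<n}. l < ?p \<or> n - l < ?p} = {0<..<?p} \<union> {n - ?p<..<n}"
    using p by auto
  moreover have "card ({0<..<?p} \<union> {n - ?p<..<n}) = card {0<..<?p} + card {n - ?p<..<n}"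
    using p by (intro card_Un_disjoint) auto
  ultimately show ?thesis using p \<open>?p > 0\<close> by (simp add: non_exceeding_count_eq_card)
qed

text \<open>The form in which the count enters the series: the term \<open>2 (p\<^sub>1(n) - 1)\<close> is uniform in \<open>n\<close> and
  can be summed by sorting \<open>n\<close> by \<open>p\<^sub>1(n)\<close>; the correction lives on primes.\<close>
lemma of_nat_non_exceeding_count:
  assumes "n \<ge> 2"
  shows "(of_nat (non_exceeding_count n) :: complex) =
    2 * (of_nat (smallest_prime_divisor n) - 1) - (if prime n then of_nat n - 1 else 0)"
proof -
  have "smallest_prime_divisor n \<ge> 1"
    using smallest_prime_divisor_props(1)[OF assms] prime_ge_1_nat by auto
  thus ?thesis using assms
    by (auto simp: non_exceeding_count_prime non_exceeding_count_composite
          smallest_prime_divisor_prime of_nat_diff)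
qed

section \<open>Summability\<close>

lemma inverse_powr_mult:
  "1 / (of_nat (m * n) :: complex) powr s = 1 / of_nat m powr s * (1 / of_nat n powr s)"
  by (simp add: powr_times_real)

lemma norm_of_nat_minus_one_le:
  assumes "1 \<le> k" "k \<le> n"
  shows "norm (of_nat k - 1 :: complex) \<le> real n"
proof -
  have "(of_nat k - 1 :: complex) = of_nat (k - 1)" using assms by (simp add: of_nat_diff)
  thus ?thesis using assms by (simp only: norm_of_nat)
qed

lemma has_sum_diff:
  fixes f g :: "'a \<Rightarrow> complex"
  assumes "(f has_sum a) A" "(g has_sum b) A"
  shows "((\<lambda>x. f x - g x) has_sum (a - b)) A"
  using has_sum_add[OF assms(1) has_sum_uminusI[OF assms(2)]] by simp

text \<open>The terms are bounded by \<open>n powr (1 - Re s)\<close>, whose exponent is below \<open>-1\<close>.\<close>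
lemma dirichlet_series_summable:
  fixes a :: "nat \<Rightarrow> complex"
  assumes "Re s > 2" "\<And>n. n \<in> A \<Longrightarrow> norm (a n) \<le> real n"
  shows "(\<lambda>n. a n * (1 / of_nat n powr s)) summable_on A"
proof -
  have "summable (\<lambda>n. real n powr (1 - Re s))"
    using assms(1) by (simp add: summable_real_powr_iff)
  hence "(\<lambda>n. real n powr (1 - Re s)) summable_on UNIV"
    by (intro norm_summable_imp_summable_on) simp
  hence S: "(\<lambda>n. real n powr (1 - Re s)) summable_on A"
    by (rule summable_on_subset_banach) simp
  have "norm (a n * (1 / of_nat n powr s)) \<le> real n powr (1 - Re s)" if "n \<in> A" for n
  proof (cases "n = 0")
    case False
    have "norm (a n * (1 / of_nat n powr s)) = norm (a n) * real n powr (- Re s)"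
      by (simp add: norm_mult norm_divide norm_powr_real_powr powr_minus field_simps)
    also have "\<dots> \<le> real n * real n powr (- Re s)"
      using assms(2)[OF that] by (intro mult_right_mono) auto
    also have "\<dots> = real n powr (1 - Re s)"
      using False by (simp add: powr_diff powr_minus field_simps)
    finally show ?thesis .
  qed auto
  from Infinite_Sum.abs_summable_on_comparison_test'[OF S this] show ?thesis
    by (simp add: summable_on_iff_abs_summable_on_complex)
qed

lemma zeta_series_summable:
  assumes "Re s > 2"
  shows "(\<lambda>n. 1 / of_nat n powr s :: complex) summable_on {1..}"
  using dirichlet_series_summable[OF assms, of "{1..}" "\<lambda>_. 1"] by simp

section \<open>Products of Dirichlet series\<close>

text \<open>For a completely multiplicative \<open>f\<close>, here \<open>n\<^sup>-\<^sup>s\<close>, the product of the two series is an absolutely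
  convergent double sum over \<open>(k, m)\<close>; collecting the terms with \<open>k m = n\<close> yields a finite sum over
  the divisors \<open>k\<close> of \<open>n\<close>.\<close>
lemma dirichlet_convolution_has_sum:
  fixes a b f :: "nat \<Rightarrow> complex"
  assumes mult: "\<And>m n. f (m * n) = f m * f n"
    and a: "(\<lambda>n. a n * f n) summable_on {1..}"
    and b: "(\<lambda>n. b n * f n) summable_on {1..}"
  shows "((\<lambda>n. (\<Sum>k | k dvd n. a k * b (n div k)) * f n) has_sum
           ((\<Sum>\<^sub>\<infinity>n\<in>{1..}. a n * f n) * (\<Sum>\<^sub>\<infinity>n\<in>{1..}. b n * f n))) {1..}"
proof -
  let ?g = "\<lambda>(k, m). (a k * f k) * (b m * f m)"
  have summable: "?g summable_on {1..} \<times> {1..}"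
  proof -
    let ?B = "\<Sum>\<^sub>\<infinity>m\<in>{1..}. norm (b m * f m)"
    have "(\<lambda>x. norm (?g x)) summable_on {1..} \<times> {1..}"
    proof (rule summable_on_SigmaI)
      show "((\<lambda>m. norm (?g (k, m))) has_sum norm (a k * f k) * ?B) {1..}" for k
        unfolding prod.case norm_mult[of "a k * f k"]
        using b by (intro has_sum_cmult_right has_sum_infsum)
          (simp only: summable_on_iff_abs_summable_on_complex)
      show "(\<lambda>k. norm (a k * f k) * ?B) summable_on {1..}"
        using a by (intro summable_on_cmult_left)
          (simp only: summable_on_iff_abs_summable_on_complex)
    qed simp
    thus ?thesis by (simp add: summable_on_iff_abs_summable_on_complex)
  qed
  have "infsum ?g ({1..} \<times> {1..}) =
      (\<Sum>\<^sub>\<infinity>n\<in>{1..}. a n * f n) * (\<Sum>\<^sub>\<infinity>n\<in>{1..}. b n * f n)"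
    by (subst infsum_Sigma_banach[OF summable, symmetric])
       (simp add: infsum_cmult_right' infsum_cmult_left')
  with has_sum_infsum[OF summable] have "(?g has_sum
      ((\<Sum>\<^sub>\<infinity>n\<in>{1..}. a n * f n) * (\<Sum>\<^sub>\<infinity>n\<in>{1..}. b n * f n))) ({1..} \<times> {1..})"
    by (simp only:)
  also have "?this \<longleftrightarrow> ((\<lambda>(n, k). a k * b (n div k) * f n) has_sum
      ((\<Sum>\<^sub>\<infinity>n\<in>{1..}. a n * f n) * (\<Sum>\<^sub>\<infinity>n\<in>{1..}. b n * f n))) (SIGMA n:{1..}. {k. k dvd n})"
    by (rule has_sum_reindex_bij_witness[where i = "\<lambda>(n, k). (k, n div k)"
          and j = "\<lambda>(k, m). (k * m, k)"]) (auto simp: mult Suc_le_eq dvd_div_eq_0_iff intro: dvd_pos_nat)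
  finally show ?thesis
    by (rule has_sum_SigmaD)
       (auto intro!: has_sum_finiteI finite_divisors_nat simp: sum_distrib_right)
qed

lemma num_divisors_has_sum:
  fixes f :: "nat \<Rightarrow> complex"
  assumes "\<And>m n. f (m * n) = f m * f n" "f summable_on {1..}"
  shows "((\<lambda>n. of_nat (num_divisors n) * f n) has_sum (infsum f {1..})\<^sup>2) {1..}"
  using dirichlet_convolution_has_sum[of f "\<lambda>_. 1" "\<lambda>_. 1"] assms
  by (simp add: num_divisors_def power2_eq_square)

lemma sum_prime_divisors:
  fixes h :: "nat \<Rightarrow> complex"
  assumes "n \<ge> 1"
  shows "(\<Sum>k | k dvd n. if prime k then h k else 0) = (\<Sum>p\<in>prime_factors n. h p)"
  using assms by (intro sum.mono_neutral_cong_right) (auto simp: prime_factors_dvd)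

text \<open>Convolution with the constant \<open>1\<close> sums over divisors, so a function supported on the primes
  becomes a sum over prime factors: \<open>h = 1\<close> gives \<open>\<omega>\<^sub>0\<close> and \<open>h(p) = p\<close> gives \<open>\<omega>\<^sub>1\<close>.\<close>
lemma prime_factors_sum_has_sum:
  fixes f h :: "nat \<Rightarrow> complex"
  assumes "\<And>m n. f (m * n) = f m * f n" "f summable_on {1..}"
    and "(\<lambda>n. (if prime n then h n else 0) * f n) summable_on {1..}"
  shows "((\<lambda>n. (\<Sum>p\<in>prime_factors n. h p) * f n) has_sum
     (\<Sum>\<^sub>\<infinity>n\<in>{1..}. (if prime n then h n else 0) * f n) * infsum f {1..}) {1..}"
proof -
  have "((\<lambda>n. (\<Sum>k | k dvd n. (if prime k then h k else 0) * 1) * f n) has_sum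
     (\<Sum>\<^sub>\<infinity>n\<in>{1..}. (if prime n then h n else 0) * f n) * (\<Sum>\<^sub>\<infinity>n\<in>{1..}. 1 * f n)) {1..}"
    using assms by (intro dirichlet_convolution_has_sum) simp_all
  also have "?this \<longleftrightarrow> ?thesis"
    unfolding mult_1 mult_1_right by (rule has_sum_cong) (simp add: sum_prime_divisors)
  finally show ?thesis .
qed

section \<open>Sorting integers by their smallest prime divisor\<close>

text \<open>Sieving by one further prime \<open>q\<close> removes the multiples of \<open>q\<close> among the remaining integers. Since
  \<open>q\<close> is coprime to the primes sieved before, these multiples are \<open>q\<close> times the remaining integers,
  and by multiplicativity they carry the fraction \<open>f q\<close> of the sum.\<close>
lemma sieved_has_sum:
  fixes f :: "nat \<Rightarrow> complex"
  assumes mult: "\<And>m n. f (m * n) = f m * f n" and f: "f summable_on {1..}"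
    and "finite Q" "\<And>q. q \<in> Q \<Longrightarrow> prime q"
  shows "(f has_sum infsum f {1..} * (\<Prod>q\<in>Q. 1 - f q)) {m \<in> {1..}. \<forall>q\<in>Q. \<not> q dvd m}"
  using assms(3,4)
proof (induction Q rule: finite_induct)
  case empty
  then show ?case using f by (simp add: atLeast_def has_sum_infsum)
next
  case (insert q Q)
  let ?A = "{m \<in> {1..}. \<forall>q\<in>Q. \<not> q dvd m}"
  let ?z = "infsum f {1..} * (\<Prod>q\<in>Q. 1 - f q)"
  have q: "prime q" using insert by simp
  have A: "(f has_sum ?z) ?A" using insert by simp
  have coprime: "p dvd q * m \<longleftrightarrow> p dvd m" if "p \<in> Q" for p m
    using that insert.hyps insert.prems q by (metis insertCI prime_dvd_mult_iff primes_dvd_imp_eq)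
  have "((\<lambda>m. f (q * m)) has_sum f q * ?z) ?A"
    unfolding mult by (rule has_sum_cmult_right[OF A])
  also have "?this \<longleftrightarrow> (f has_sum f q * ?z) {m \<in> ?A. q dvd m}"
    using q by (intro has_sum_reindex_bij_witness[where i = "\<lambda>m. m div q" and j = "\<lambda>m. q * m"])
      (auto simp: coprime prime_gt_0_nat Suc_le_eq elim!: dvdE)
  finally have "(f has_sum ?z - f q * ?z) (?A - {m \<in> ?A. q dvd m})"
    by (rule has_sum_Diff[OF A]) auto
  also have "?A - {m \<in> ?A. q dvd m} = {m \<in> {1..}. \<forall>p\<in>insert q Q. \<not> p dvd m}" by auto
  finally show ?case using insert.hyps by (simp add: algebra_simps)
qed

lemma smallest_prime_divisor_mult:
  assumes "prime p" "m \<ge> 1" "\<forall>q\<in>{q. prime q \<and> q \<le> p - 1}. \<not> q dvd m"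
  shows "smallest_prime_divisor (p * m) = p"
proof (rule smallest_prime_divisor_eqI)
  fix q assume q: "prime q" "q dvd p * m"
  show "p \<le> q"
  proof (cases "q dvd p")
    case True thus ?thesis using q assms by (auto dest: primes_dvd_imp_eq)
  next
    case False
    hence "q dvd m" using q by (simp add: prime_dvd_mult_iff)
    thus ?thesis using q assms(3) by (metis (mono_tags, lifting) Suc_pred' assms(1) mem_Collect_eq not_less_eq_eq prime_gt_0_nat)
  qed
qed (use assms in auto)

text \<open>Dividing \<open>n\<close> once by \<open>p = p\<^sub>1(n)\<close> leaves a cofactor without prime divisors below \<open>p\<close> (it may
  still be divisible by \<open>p\<close>), and multiplying such a cofactor by \<open>p\<close> restores \<open>p\<close> as the smallest
  prime divisor.\<close>
lemma has_sum_by_smallest_prime_divisor: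
  fixes g :: "nat \<Rightarrow> complex"
  shows "(g has_sum S) {2..} \<longleftrightarrow> ((\<lambda>(p, m). g (p * m)) has_sum S)
     (SIGMA p:{p. prime p}. {m \<in> {1..}. \<forall>q\<in>{q. prime q \<and> q \<le> p - 1}. \<not> q dvd m})"
proof (rule has_sum_reindex_bij_witness[where j = "\<lambda>n. (smallest_prime_divisor n, n div smallest_prime_divisor n)"
      and i = "\<lambda>(p, m). p * m"])
  fix n :: nat assume "n \<in> {2..}"
  hence n: "n \<ge> 2" by simp
  note p = smallest_prime_divisor_props[OF n]
  have "n div smallest_prime_divisor n \<ge> 1"
    using p n by (metis One_nat_def Suc_leI div_greater_zero_iff dvd_imp_le not_gr0 prime_gt_0_nat
        le_zero_eq numeral_2_eq_2 nat.distinct(1))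
  moreover have "\<not> q dvd n div smallest_prime_divisor n"
    if "prime q" "q \<le> smallest_prime_divisor n - 1" for q
  proof
    assume "q dvd n div smallest_prime_divisor n"
    hence "q dvd n" using p(2) by (metis dvd_div_mult_self dvd_mult2)
    thus False using p(3)[OF that(1)] that(2) prime_gt_0_nat[OF p(1)] by simp
  qed
  ultimately show "(smallest_prime_divisor n, n div smallest_prime_divisor n) \<in>
      (SIGMA p:{p. prime p}. {m \<in> {1..}. \<forall>q\<in>{q. prime q \<and> q \<le> p - 1}. \<not> q dvd m})"
    using p(1) by auto
  show "(case (smallest_prime_divisor n, n div smallest_prime_divisor n) of (p, m) \<Rightarrow> p * m) = n"
    using p by simp
  thus "(case (smallest_prime_divisor n, n div smallest_prime_divisor n) of (p, m) \<Rightarrow> g (p * m)) = g n"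
    by simp
next
  fix x assume "x \<in> (SIGMA p:{p. prime p}. {m \<in> {1::nat..}. \<forall>q\<in>{q. prime q \<and> q \<le> p - 1}. \<not> q dvd m})"
  then obtain p m where x: "x = (p, m)" "prime p" "m \<ge> 1"
      "\<forall>q\<in>{q. prime q \<and> q \<le> p - 1}. \<not> q dvd m" by auto
  have "smallest_prime_divisor (p * m) = p" using x(2-4) by (rule smallest_prime_divisor_mult)
  thus "(smallest_prime_divisor (case x of (p, m) \<Rightarrow> p * m),
         (case x of (p, m) \<Rightarrow> p * m) div smallest_prime_divisor (case x of (p, m) \<Rightarrow> p * m)) = x"
    using x by (simp add: prime_gt_0_nat)
  have "2 * 1 \<le> p * m" using x(3) prime_ge_2_nat[OF x(2)] by (rule mult_le_mono[rotated])
  thus "(case x of (p, m) \<Rightarrow> p * m) \<in> {2..}" using x by simp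
qed simp

text \<open>A bound that does not depend on \<open>Q\<close>, so that the finite products in the sum over primes do not
  disturb its convergence.\<close>
lemma euler_product_norm_bound:
  fixes f :: "nat \<Rightarrow> complex"
  assumes f: "f summable_on {1..}" and Q: "finite Q" "Q \<subseteq> {1..}"
  shows "norm (\<Prod>q\<in>Q. 1 - f q) \<le> exp (\<Sum>\<^sub>\<infinity>n\<in>{1..}. norm (f n))"
proof -
  have "norm (\<Prod>q\<in>Q. 1 - f q) = (\<Prod>q\<in>Q. norm (1 - f q))" by (simp add: prod_norm)
  also have "\<dots> \<le> (\<Prod>q\<in>Q. 1 + norm (f q))"
    by (intro prod_mono) (metis norm_ge_zero norm_one norm_triangle_ineq4)
  also have "\<dots> \<le> exp (\<Sum>q\<in>Q. norm (f q))" by (rule prod_le_exp_sum) auto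
  also have "\<dots> \<le> exp (\<Sum>\<^sub>\<infinity>n\<in>{1..}. norm (f n))"
    using f Q by (subst exp_le_cancel_iff, intro finite_sum_le_infsum)
      (auto simp: summable_on_iff_abs_summable_on_complex)
  finally show ?thesis .
qed

lemma prime_summand_summable:
  assumes "Re s > 2"
  shows "prime_summand s summable_on {p. prime p}"
proof -
  let ?f = "\<lambda>n. 1 / of_nat n powr s :: complex"
  have f: "?f summable_on {1..}" using assms by (rule zeta_series_summable)
  let ?C = "exp (\<Sum>\<^sub>\<infinity>n\<in>{1..}. norm (?f n))"
  have "(\<lambda>p. norm ((of_nat p - 1) * ?f p)) summable_on {p. prime p}"
    by (subst summable_on_iff_abs_summable_on_complex[symmetric], rule dirichlet_series_summable[OF assms])
       (auto intro: norm_of_nat_minus_one_le prime_ge_1_nat)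
  hence "(\<lambda>p. norm ((of_nat p - 1) * ?f p) * ?C) summable_on {p. prime p}"
    by (rule summable_on_cmult_left)
  moreover have "norm (prime_summand s p) \<le> norm ((of_nat p - 1) * ?f p) * ?C" for p
  proof -
    have "norm (\<Prod>q | prime q \<and> q \<le> p - 1. 1 - ?f q) \<le> ?C"
      using f by (rule euler_product_norm_bound) (auto intro: Suc_leI prime_gt_0_nat)
    hence "norm ((of_nat p - 1) * ?f p) * norm (\<Prod>q | prime q \<and> q \<le> p - 1. 1 - ?f q)
        \<le> norm ((of_nat p - 1) * ?f p) * ?C"
      by (rule mult_left_mono) simp
    thus ?thesis by (simp add: prime_summand_def norm_mult norm_divide)
  qed
  ultimately show ?thesis
    by (simp only: summable_on_iff_abs_summable_on_complex) (rule Infinite_Sum.abs_summable_on_comparison_test')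
qed

text \<open>For a fixed smallest prime divisor \<open>p\<close> the coefficient is the constant \<open>p - 1\<close>, so the inner sum
  is a sieved zeta series and the outer sum runs over the primes.\<close>
lemma smallest_prime_divisor_has_sum:
  assumes "Re s > 2"
  shows "((\<lambda>n. (of_nat (smallest_prime_divisor n) - 1) * (1 / of_nat n powr s)) has_sum
     (\<Sum>\<^sub>\<infinity>p\<in>{p. prime p}. prime_summand s p) * riemann_zeta s) {2..}"
proof -
  let ?f = "\<lambda>n. 1 / of_nat n powr s :: complex"
  let ?g = "\<lambda>n. (of_nat (smallest_prime_divisor n) - 1) * ?f n"
  let ?R = "\<lambda>p. {m \<in> {1::nat..}. \<forall>q\<in>{q. prime q \<and> q \<le> p - 1}. \<not> q dvd m}"
  have f: "?f summable_on {1..}" using assms by (rule zeta_series_summable)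
  have g: "?g summable_on {2..}"
  proof (rule dirichlet_series_summable[OF assms])
    fix n :: nat assume "n \<in> {2..}"
    hence n: "n \<ge> 2" by simp
    note p = smallest_prime_divisor_props[OF n]
    have "smallest_prime_divisor n \<le> n" using p(2) n by (intro dvd_imp_le) auto
    moreover have "smallest_prime_divisor n \<ge> 1" using p(1) by (rule prime_ge_1_nat)
    ultimately show "cmod (of_nat (smallest_prime_divisor n) - 1) \<le> real n"
      by (rule norm_of_nat_minus_one_le[rotated])
  qed
  have "((\<lambda>(p, m). ?g (p * m)) has_sum infsum ?g {2..}) (Sigma {p. prime p} ?R)"
    by (rule has_sum_by_smallest_prime_divisor[THEN iffD1, OF has_sum_infsum[OF g]])
  hence "((\<lambda>p. riemann_zeta s * prime_summand s p) has_sum infsum ?g {2..}) {p. prime p}"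
  proof (rule has_sum_SigmaD)
    fix p :: nat assume "p \<in> {p. prime p}"
    hence p: "prime p" by simp
    have "(?f has_sum riemann_zeta s * (\<Prod>q | prime q \<and> q \<le> p - 1. 1 - ?f q)) (?R p)"
      unfolding riemann_zeta_def by (rule sieved_has_sum[OF inverse_powr_mult f]) auto
    hence "((\<lambda>m. ((of_nat p - 1) * ?f p) * ?f m) has_sum
        ((of_nat p - 1) * ?f p) * (riemann_zeta s * (\<Prod>q | prime q \<and> q \<le> p - 1. 1 - ?f q))) (?R p)"
      by (rule has_sum_cmult_right)
    moreover have "((of_nat p - 1) * ?f p) * ?f m = ?g (p * m)" if "m \<in> ?R p" for m
      using that p by (subst smallest_prime_divisor_mult) (auto simp: inverse_powr_mult powr_times_real)
    ultimately have "((\<lambda>m. ?g (p * m)) has_sum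
        ((of_nat p - 1) * ?f p) * (riemann_zeta s * (\<Prod>q | prime q \<and> q \<le> p - 1. 1 - ?f q))) (?R p)"
      by (rule has_sum_cong[THEN iffD1, rotated])
    thus "((\<lambda>m. case (p, m) of (p, m) \<Rightarrow> ?g (p * m)) has_sum riemann_zeta s * prime_summand s p) (?R p)"
      by (simp add: prime_summand_def mult_ac)
  qed
  from infsumI[OF this] have "infsum ?g {2..} =
     (\<Sum>\<^sub>\<infinity>p\<in>{p. prime p}. prime_summand s p) * riemann_zeta s"
    by (simp only: infsum_cmult_right' mult.commute)
  with has_sum_infsum[OF g] show ?thesis by (simp only:)
qed

section \<open>The identity\<close>

theorem proposition4p13:
  fixes s :: complex
  assumes "Re s > 2"
  shows "(\<lambda>n. 1 / of_nat n powr s) summable_on {1::nat..} \<and>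
    (\<lambda>n. of_nat (non_exceeding_count n) / of_nat n powr s) summable_on {2..} \<and>
    (\<lambda>n. of_nat (num_divisors n) / of_nat n powr s) summable_on {1..} \<and>
    prime_summand s summable_on {p. prime p} \<and>
    (\<lambda>n. of_nat (omega0 n) / of_nat n powr s) summable_on {1..} \<and>
    (\<lambda>n. of_nat (omega1 n) / of_nat n powr s) summable_on {1..} \<and>
    D2 s * riemann_zeta s =
      2 * (\<Sum>\<^sub>\<infinity>n\<in>{1..}. of_nat (num_divisors n) / of_nat n powr s) *
        (\<Sum>\<^sub>\<infinity>p\<in>{p. prime p}. prime_summand s p)
      + (\<Sum>\<^sub>\<infinity>n\<in>{1..}. of_nat (omega0 n) / of_nat n powr s)
      - (\<Sum>\<^sub>\<infinity>n\<in>{1..}. of_nat (omega1 n) / of_nat n powr s)"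
proof -
  define f where "f = (\<lambda>n. 1 / of_nat n powr s :: complex)"
  define Z where "Z = riemann_zeta s"
  define P where "P = (\<Sum>\<^sub>\<infinity>p\<in>{p. prime p}. prime_summand s p)"
  define u :: "nat \<Rightarrow> complex" where "u = (\<lambda>n. if prime n then 1 else 0)"
  define v :: "nat \<Rightarrow> complex" where "v = (\<lambda>n. if prime n then of_nat n else 0)"
  define g where "g = (\<lambda>n. (of_nat (smallest_prime_divisor n) - 1) * f n)"
  define S0 where "S0 = (\<Sum>\<^sub>\<infinity>n\<in>{1..}. u n * f n)"
  define S1 where "S1 = (\<Sum>\<^sub>\<infinity>n\<in>{1..}. v n * f n)"
  have mult: "f (m * n) = f m * f n" for m n
    unfolding f_def by (rule inverse_powr_mult)
  have summable: "(\<lambda>n. a n * f n) summable_on A" if "\<And>n. n \<in> A \<Longrightarrow> norm (a n) \<le> real n" for a A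
    unfolding f_def using assms that by (rule dirichlet_series_summable)
  have f: "f summable_on {1..}" unfolding f_def using assms by (rule zeta_series_summable)
  have Z: "infsum f {1..} = Z" by (simp add: Z_def f_def riemann_zeta_def)
  have u: "(\<lambda>n. u n * f n) summable_on {1..}" by (rule summable) (auto simp: u_def)
  have v: "(\<lambda>n. v n * f n) summable_on {1..}" by (rule summable) (auto simp: v_def)
  have d: "((\<lambda>n. of_nat (num_divisors n) * f n) has_sum Z\<^sup>2) {1..}"
    using num_divisors_has_sum[OF mult f] unfolding Z .
  have o0: "((\<lambda>n. of_nat (omega0 n) * f n) has_sum S0 * Z) {1..}"
    using prime_factors_sum_has_sum[OF mult f, of "\<lambda>_. 1"] u
    by (simp add: u_def S0_def Z[symmetric] omega0_def)
  have o1: "((\<lambda>n. of_nat (omega1 n) * f n) has_sum S1 * Z) {1..}"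
    using prime_factors_sum_has_sum[OF mult f, of of_nat] v
    by (simp add: v_def S1_def Z[symmetric] omega1_def)
  have G: "(g has_sum P * Z) {2..}"
    using smallest_prime_divisor_has_sum[OF assms] by (simp only: g_def f_def P_def Z_def)
  have V: "((\<lambda>n. v n * f n - u n * f n) has_sum S1 - S0) {2..}"
  proof -
    have "((\<lambda>n. v n * f n - u n * f n) has_sum S1 - S0) {1..}"
      using u v by (auto simp: S0_def S1_def intro!: has_sum_diff has_sum_infsum)
    \<comment> \<open>The series \<open>D\<^sub>2\<close> starts at \<open>2\<close>; the prime indicator vanishes at \<open>1\<close>.\<close>
    also have "?this \<longleftrightarrow> ?thesis"
      by (rule has_sum_cong_neutral) (auto simp: u_def v_def dest: prime_ge_2_nat)
    finally show ?thesis .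
  qed
  have "((\<lambda>n. 2 * g n - (v n * f n - u n * f n)) has_sum 2 * (P * Z) - (S1 - S0)) {2..}"
    by (rule has_sum_diff[OF has_sum_cmult_right[OF G] V])
  moreover have "2 * g n - (v n * f n - u n * f n) = of_nat (non_exceeding_count n) * f n"
    if "n \<in> {2..}" for n
    using that by (auto simp: of_nat_non_exceeding_count g_def u_def v_def algebra_simps)
  ultimately have D: "((\<lambda>n. of_nat (non_exceeding_count n) * f n) has_sum 2 * (P * Z) - (S1 - S0)) {2..}"
    by (rule has_sum_cong[THEN iffD1, rotated])
  have "D2 s = 2 * (P * Z) - (S1 - S0)"
    using infsumI[OF D] by (simp add: D2_def f_def)
  hence "D2 s * Z = 2 * Z\<^sup>2 * P + S0 * Z - S1 * Z"
    by (simp only:) (simp add: algebra_simps power2_eq_square)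
  thus ?thesis
    using f has_sum_imp_summable[OF D] has_sum_imp_summable[OF d] has_sum_imp_summable[OF o0]
      has_sum_imp_summable[OF o1] infsumI[OF d] infsumI[OF o0] infsumI[OF o1]
      prime_summand_summable[OF assms]
    by (simp add: f_def Z_def P_def)
qed

end
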